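(* Let $N^1:=\max(N_1,N_2,N_3)$. For every $\epsilon>0$, with $S(n_1),S(n_2),S(n_3)$ the sets defined in the context, $$\#S(n_1)\lesssim_\epsilon(N^1)^\epsilon N_2N_3,\qquad\#S(n_2)\lesssim_\epsilon(N^1)^\epsilon N_1N_3,\qquad\#S(n_3)\lesssim_\epsilon(N^1)^\epsilon N_1N_2,$$ for all fixed $n_1$, $n_2$, $n_3$ respectively, with implicit constants independent of $\mu,N_1,N_2,N_3$ and of the fixed vectors.
   Context: Fix a real number $\gamma\in(1,2)$. For $n,m\in\mathbb{Z}^2$ let $\langle n,m\rangle=n_1m_1+\gamma n_2m_2$ (coordinates) and $|n|=\sqrt{\langle n,n\rangle}$. Fix a constant $K\ge1$, numbers $N_1,N_2,N_3\ge1$ and $\mu\in\mathbb{R}$ with $|\mu|\le K\max(N_1,N_2,N_3)$. Let $$S=\{(n_1,n_2,n_3)\in(\mathbb{Z}^2)^3:\ |n_i|\sim N_i\ (i=1,2,3),\ n_2\ne n_1,\ n_2\neq n_3,\ \langle n_2-n_1,n_2-n_3\rangle=\mu+O(1)\},$$ where $|n_i|\sim N_i$ means $N_i/K\le|n_i|\le KN_i$ and $a=\mu+O(1)$ means $|a-\mu|\le K$. For fixed $n_1$ let $S(n_1)=\{(n_2,n_3):(n_1,n_2,n_3)\in S\}$; for fixed $n_2$ let $S(n_2)=\{(n_1,n_3):(n_1,n_2,n_3)\in S\}$; for fixed $n_3$ let $S(n_3)=\{(n_1,n_2):(n_1,n_2,n_3)\in S\}$. Implicit constants in $\lesssim_\epsilon$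 may depend on $K$ and $\epsilon$ (and $\gamma$). *)

theory Defs
  imports Complex_Main "HOL-Library.Product_Plus"
begin

text \<open>The form associated with the (possibly irrational) torus of parameter \<open>\<gamma>\<close>;
  \<open>\<int>\<^sup>2\<close> is the type \<open>int \<times> int\<close> with its componentwise group structure.\<close>

definition inner_g :: "real \<Rightarrow> int \<times> int \<Rightarrow> int \<times> int \<Rightarrow> real" where
  "inner_g \<gamma> n m = real_of_int (fst n) * real_of_int (fst m)
                 + \<gamma> * real_of_int (snd n) * real_of_int (snd m)"

definition norm_g :: "real \<Rightarrow> int \<times> int \<Rightarrow> real" where
  "norm_g \<gamma> n = sqrt (inner_g \<gamma> n n)"

text \<open>\<open>x \<sim> N\<close> and \<open>a = \<mu> + O(1)\<close>, with the single fixed constant \<open>K\<close> playing both roles.\<close>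

definition comparable :: "real \<Rightarrow> real \<Rightarrow> real \<Rightarrow> bool" where
  "comparable K x N \<longleftrightarrow> N / K \<le> x \<and> x \<le> K * N"

definition within_O1 :: "real \<Rightarrow> real \<Rightarrow> real \<Rightarrow> bool" where
  "within_O1 K a \<mu> \<longleftrightarrow> \<bar>a - \<mu>\<bar> \<le> K"

definition S :: "real \<Rightarrow> real \<Rightarrow> real \<Rightarrow> real \<Rightarrow> real \<Rightarrow> real
    \<Rightarrow> ((int \<times> int) \<times> (int \<times> int) \<times> (int \<times> int)) set" where
  "S \<gamma> K N1 N2 N3 \<mu> = {(n1, n2, n3).
      comparable K (norm_g \<gamma> n1) N1 \<and> comparable K (norm_g \<gamma> n2) N2 \<and>
      comparable K (norm_g \<gamma> n3) N3 \<and>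
      n2 \<noteq> n1 \<and> n2 \<noteq> n3 \<and>
      within_O1 K (inner_g \<gamma> (n2 - n1) (n2 - n3)) \<mu>}"

definition S1 :: "real \<Rightarrow> real \<Rightarrow> real \<Rightarrow> real \<Rightarrow> real \<Rightarrow> real
    \<Rightarrow> int \<times> int \<Rightarrow> ((int \<times> int) \<times> (int \<times> int)) set" where
  "S1 \<gamma> K N1 N2 N3 \<mu> n1 = {(n2, n3). (n1, n2, n3) \<in> S \<gamma> K N1 N2 N3 \<mu>}"

definition S2 :: "real \<Rightarrow> real \<Rightarrow> real \<Rightarrow> real \<Rightarrow> real \<Rightarrow> real
    \<Rightarrow> int \<times> int \<Rightarrow> ((int \<times> int) \<times> (int \<times> int)) set" where
  "S2 \<gamma> K N1 N2 N3 \<mu> n2 = {(n1, n3). (n1, n2, n3) \<in> S \<gamma> K N1 N2 N3 \<mu>}"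

definition S3 :: "real \<Rightarrow> real \<Rightarrow> real \<Rightarrow> real \<Rightarrow> real \<Rightarrow> real
    \<Rightarrow> int \<times> int \<Rightarrow> ((int \<times> int) \<times> (int \<times> int)) set" where
  "S3 \<gamma> K N1 N2 N3 \<mu> n3 = {(n1, n2). (n1, n2, n3) \<in> S \<gamma> K N1 N2 N3 \<mu>}"

text \<open>Cardinality bounds include finiteness, since \<open>card\<close> is \<open>0\<close> on infinite sets.\<close>

definition card_bounded :: "'a set \<Rightarrow> real \<Rightarrow> bool" where
  "card_bounded A B \<longleftrightarrow> finite A \<and> real (card A) \<le> B"

end

theory Submission
  imports Defs "HOL-Computational_Algebra.Primes"
begin

text \<open>
  Put \<open>a = n2 - n1\<close> and \<open>b = n2 - n3\<close>. The condition defining \<open>S\<close> reads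
  \<open>u + \<gamma> v = \<mu> + O(1)\<close> with the integers \<open>u = a\<^sub>1 b\<^sub>1\<close> and \<open>v = a\<^sub>2 b\<^sub>2\<close>. Fix one of the three
  vectors and let the other two run through balls of radius of order \<open>X\<close> and \<open>Y\<close>.

  The second coordinates of the two free vectors take only \<open>O(X Y)\<close> values, and they determine
  \<open>v\<close>. Then \<open>u\<close> lies in an interval of bounded length, and a nonzero value of \<open>u\<close> has at most
  \<open>O((N^1)^\<epsilon>)\<close> factorisations \<open>a\<^sub>1 b\<^sub>1\<close> by the divisor bound. This settles the solutions with
  \<open>u \<noteq> 0\<close>. As \<open>\<gamma>\<close> is bounded below, the two coordinates play the same role, which settles those
  with \<open>v \<noteq> 0\<close>.

  If \<open>u = v = 0\<close>, then, \<open>a\<close> and \<open>b\<close> being nonzero, either \<open>a\<^sub>1 = b\<^sub>2 = 0\<close> or \<open>b\<^sub>1 = a\<^sub>2 = 0\<close>.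
  Of the free pair of first coordinates one condition leaves \<open>O(Y)\<close> (or \<open>O(X)\<close>) choices, and
  the other condition leaves \<open>O(X)\<close> (or \<open>O(Y)\<close>) pairs of second coordinates, so that there are
  \<open>O(X Y)\<close> such solutions.

  The divisor bound is \<open>card_divisors_subpolynomial\<close>, the count is \<open>card_near_solutions_le\<close>, and
  the lemmas \<open>outer_shifts_bounds\<close> and \<open>middle_shifts_bounds\<close> supply its hypotheses.
\<close>

section \<open>The divisor bound\<close>

lemma finite_dvd_nat: "0 < n \<Longrightarrow> finite {d::nat. d dvd n}"
  by simp

lemma card_divisors_mult_le:
  fixes m n :: nat
  assumes "0 < m" "0 < n"
  shows "card {d. d dvd m * n} \<le> card {d. d dvd m} * card {d. d dvd n}"
proof -
  have "{d. d dvd m * n} \<subseteq> (\<lambda>(x, y). x * y) ` ({d. d dvd m} \<times> {d. d dvd n})"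
  proof
    fix d assume "d \<in> {d. d dvd m * n}"
    then obtain x y where "d = x * y" "x dvd m" "y dvd n"
      using division_decomp by blast
    then show "d \<in> (\<lambda>(x, y). x * y) ` ({d. d dvd m} \<times> {d. d dvd n})" by force
  qed
  then have "card {d. d dvd m * n} \<le> card ({d. d dvd m} \<times> {d. d dvd n})"
    using assms by (intro surj_card_le) auto
  then show ?thesis by (simp add: card_cartesian_product)
qed

lemma card_divisors_prime_power_le:
  fixes p :: nat
  assumes "prime p"
  shows "card {d. d dvd p ^ e} \<le> e + 1"
proof -
  have "{d. d dvd p ^ e} \<subseteq> (\<lambda>i. p ^ i) ` {..e}"
    using assms by (auto simp: divides_primepow_nat)
  then have "card {d. d dvd p ^ e} \<le> card {..e}"
    by (rule surj_card_le[rotated]) simp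
  then show ?thesis by simp
qed

text \<open>Split off the full power \<open>p ^ e\<close> of one prime after the other. It multiplies the number
  of divisors by at most \<open>e + 1\<close> and \<open>n powr \<epsilon>\<close> by \<open>p powr (\<epsilon> * e)\<close>; a constant factor \<open>c\<close> is lost
  only when \<open>p\<close> is below a threshold \<open>B\<close> that depends on \<open>\<epsilon>\<close> alone. Hence the total loss is
  at most \<open>c ^ k\<close>, where \<open>k\<close> bounds the number of primes below \<open>B\<close>.\<close>

lemma card_divisors_subpolynomial:
  fixes \<epsilon> :: real
  assumes "0 < \<epsilon>"
  shows "\<exists>C\<ge>1. \<forall>n::nat. 0 < n \<longrightarrow> real (card {d. d dvd n}) \<le> C * real n powr \<epsilon>"
proof -
  define B where "B = 2 powr (1 / \<epsilon>)"
  define c where "c = 1 + 1 / (\<epsilon> * ln 2)"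
  define small where "small n = {p::nat. prime p \<and> real p < B \<and> p dvd n}" for n
  have c1: "c \<ge> 1" using assms by (simp add: c_def)
  \<comment> \<open>The threshold \<open>B\<close> is chosen so that \<open>p powr \<epsilon> \<ge> 2\<close> from there on, and then \<open>e + 1 \<le> 2 ^ e\<close>
      suffices. For smaller primes only \<open>p \<ge> 2\<close> is available; \<open>c\<close> comes from
      \<open>exp t \<ge> 1 + t\<close> with \<open>t = e * \<epsilon> * ln 2\<close>.\<close>
  have large: "real e + 1 \<le> real (p ^ e) powr \<epsilon>" if "B \<le> real p" for e p :: nat
  proof -
    have Bpos: "B > 0" by (simp add: B_def)
    have "2 = B powr \<epsilon>" using assms by (simp add: B_def powr_powr)
    also have "\<dots> \<le> real p powr \<epsilon>" using that Bpos assms by (intro powr_mono2) auto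
    finally have "2 ^ e \<le> (real p powr \<epsilon>) ^ e" by (intro power_mono) auto
    also have "\<dots> = real (p ^ e) powr \<epsilon>"
      by (induction e) (simp_all add: powr_mult)
    finally have "2 ^ e \<le> real (p ^ e) powr \<epsilon>" .
    moreover have "real e + 1 \<le> 2 ^ e"
    proof -
      have "e + 1 \<le> 2 ^ e" by (metis Suc_eq_plus1 Suc_leI less_exp)
      then have "real (e + 1) \<le> real (2 ^ e)" by (simp only: of_nat_le_iff)
      then show ?thesis by simp
    qed
    ultimately show ?thesis by linarith
  qed
  have any: "real e + 1 \<le> c * real (p ^ e) powr \<epsilon>" if "prime p" for e p :: nat
  proof -
    let ?t = "real e * (\<epsilon> * ln 2)"
    have pos: "\<epsilon> * ln 2 > 0" using assms by simp
    have t0: "?t \<ge> 0" using pos by simp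
    have "real e + 1 \<le> c * (1 + ?t)"
    proof -
      have "c * (1 + ?t) = 1 + 1 / (\<epsilon> * ln 2) + ?t + real e"
        unfolding c_def using pos assms by (simp add: field_simps)
      moreover have "1 / (\<epsilon> * ln 2) \<ge> 0" using pos by simp
      ultimately show ?thesis using t0 by linarith
    qed
    also have "\<dots> \<le> c * exp ?t" using c1 by (intro mult_left_mono exp_ge_add_one_self) auto
    also have "exp ?t = (2 ^ e) powr \<epsilon>"
      by (simp add: powr_def ln_realpow mult_ac)
    also have "(2 ^ e) powr \<epsilon> \<le> real (p ^ e) powr \<epsilon>"
    proof (intro powr_mono2)
      have "2 \<le> p" using that by (rule prime_ge_2_nat)
      then show "2 ^ e \<le> real (p ^ e)" by (simp add: power_mono)
    qed (use assms in auto)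
    finally show ?thesis using c1 by simp
  qed
  have strip: "real (card {d. d dvd n}) \<le> c ^ card (small n) * real n powr \<epsilon>" if "0 < n" for n
    using that
  proof (induction n rule: less_induct)
    case (less n)
    show ?case
    proof (cases "n = 1")
      case True
      then show ?thesis using c1 by (simp add: one_le_power)
    next
      case False
      then obtain p where p: "prime p" "p dvd n" using prime_factor_nat by blast
      define e where "e = multiplicity p n"
      obtain m where m: "n = p ^ e * m" "\<not> p dvd m"
        using multiplicity_decompose'[of n p] p less.prems unfolding e_def
        by (metis not_prime_unit neq0_conv)
      have m0: "0 < m" using m less.prems by (auto intro: gr0I)
      have e1: "e \<ge> 1"
        using p less.prems unfolding e_def
        by (simp add: Suc_le_eq prime_multiplicity_gt_zero_iff)
      have pe: "p ^ e > 1" using p e1 by (metis One_nat_def Suc_le_lessD one_less_power prime_gt_1_nat)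
      have mn: "m < n" using m m0 pe by simp
      have fin: "finite (small n)"
        using less.prems by (intro finite_subset[OF _ finite_dvd_nat[of n]]) (auto simp: small_def)
      have sub: "small m \<subseteq> small n" using m by (auto simp: small_def)
      have factor: "(real e + 1) * c ^ card (small m) \<le> c ^ card (small n) * real (p ^ e) powr \<epsilon>"
      proof (cases "real p < B")
        case True
        have "small m \<subset> small n" using sub p True m by (auto simp: small_def)
        then have "card (small m) + 1 \<le> card (small n)"
          using fin psubset_card_mono by (metis Suc_eq_plus1 Suc_leI)
        then have "c ^ (card (small m) + 1) \<le> c ^ card (small n)"
          using c1 by (rule power_increasing)
        then have "c ^ card (small m) * c * real (p ^ e) powr \<epsilon> \<le> c ^ card (small n) * real (p ^ e) powr \<epsilon>"
          by (intro mult_right_mono) (auto simp: mult.commute)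
        moreover have "(real e + 1) * c ^ card (small m) \<le> c * real (p ^ e) powr \<epsilon> * c ^ card (small m)"
          using any[OF p(1)] c1 by (intro mult_right_mono) auto
        ultimately show ?thesis by (simp add: mult_ac)
      next
        case False
        have "card (small m) \<le> card (small n)" using sub fin by (rule card_mono[rotated])
        then have "c ^ card (small m) \<le> c ^ card (small n)" using c1 by (rule power_increasing)
        then have "(real e + 1) * c ^ card (small m) \<le> real (p ^ e) powr \<epsilon> * c ^ card (small n)"
          using large[of p e] False c1 by (intro mult_mono) auto
        then show ?thesis by (simp add: mult_ac)
      qed
      have "real (card {d. d dvd n}) \<le> real (card {d. d dvd p ^ e} * card {d. d dvd m})"
        unfolding m(1) using card_divisors_mult_le[of "p ^ e" m] m0 pe by (simp only: of_nat_le_iff)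
      also have "\<dots> = real (card {d. d dvd p ^ e}) * real (card {d. d dvd m})" by simp
      also have "\<dots> \<le> (real e + 1) * (c ^ card (small m) * real m powr \<epsilon>)"
      proof (intro mult_mono)
        show "real (card {d. d dvd p ^ e}) \<le> real e + 1"
          using card_divisors_prime_power_le[OF p(1), of e] by linarith
      qed (use less.IH[OF mn m0] in auto)
      also have "\<dots> = ((real e + 1) * c ^ card (small m)) * real m powr \<epsilon>" by simp
      also have "\<dots> \<le> (c ^ card (small n) * real (p ^ e) powr \<epsilon>) * real m powr \<epsilon>"
        by (intro mult_right_mono factor) auto
      also have "\<dots> = c ^ card (small n) * real n powr \<epsilon>"
        by (simp add: m(1) powr_mult)
      finally show ?thesis .
    qed
  qed
  define k where "k = card {p::nat. real p < B}"
  have finB: "finite {p::nat. real p < B}"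
    by (rule finite_subset[of _ "{..nat \<lceil>B\<rceil>}"]) (auto, linarith)
  have "real (card {d. d dvd n}) \<le> c ^ k * real n powr \<epsilon>" if "0 < n" for n :: nat
  proof -
    have "card (small n) \<le> k" unfolding k_def
      by (rule card_mono[OF finB]) (auto simp: small_def)
    then have "c ^ card (small n) \<le> c ^ k" using c1 by (rule power_increasing)
    then have "c ^ card (small n) * real n powr \<epsilon> \<le> c ^ k * real n powr \<epsilon>"
      by (intro mult_right_mono) auto
    then show ?thesis using strip[OF that] by linarith
  qed
  moreover have "c ^ k \<ge> 1" using c1 by (rule one_le_power)
  ultimately show ?thesis by blast
qed

text \<open>A factorisation of \<open>u \<noteq> 0\<close> is determined by its first factor, which up to sign is a divisor
  of \<open>\<bar>u\<bar> \<le> M\<^sup>2\<close>; the divisor bound with exponent \<open>\<epsilon> / 2\<close> therefore gives \<open>M powr \<epsilon>\<close>.\<close>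

lemma card_factor_pairs_subpolynomial:
  fixes \<epsilon> :: real
  assumes "0 < \<epsilon>"
  obtains D where "1 \<le> D"
    and "\<forall>M\<ge>1. \<forall>u\<noteq>0. \<forall>R :: (int \<times> int) set.
      (\<forall>z\<in>R. \<bar>real_of_int (fst z)\<bar> \<le> M \<and> \<bar>real_of_int (snd z)\<bar> \<le> M) \<longrightarrow>
      real (card {z\<in>R. fst z * snd z = u}) \<le> D * M powr \<epsilon>"
proof -
  obtain C where C: "C \<ge> 1" "\<And>n::nat. 0 < n \<Longrightarrow> real (card {d. d dvd n}) \<le> C * real n powr (\<epsilon> / 2)"
    using card_divisors_subpolynomial[of "\<epsilon> / 2"] assms by auto
  have bound: "real (card {z\<in>R. fst z * snd z = u}) \<le> (2 * C) * M powr \<epsilon>"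
    if M: "M \<ge> 1" and u: "u \<noteq> 0"
      and R: "\<forall>z\<in>R. \<bar>real_of_int (fst z)\<bar> \<le> M \<and> \<bar>real_of_int (snd z)\<bar> \<le> M"
    for M u and R :: "(int \<times> int) set"
  proof (cases "{z\<in>R. fst z * snd z = u} = {}")
    case True
    then have "card {z\<in>R. fst z * snd z = u} = 0" by (simp only: card.empty)
    then show ?thesis using C by simp
  next
    case False
    then obtain z where z: "z \<in> R" "fst z * snd z = u" by auto
    let ?n = "nat \<bar>u\<bar>"
    let ?Z = "{z\<in>R. fst z * snd z = u}"
    let ?D = "{d::nat. d dvd ?n}"
    have finD: "finite ?D" using u by (intro finite_dvd_nat) simp
    have "fst ` ?Z \<subseteq> int ` ?D \<union> (\<lambda>d. - int d) ` ?D"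
    proof
      fix a assume "a \<in> fst ` ?Z"
      then have "nat \<bar>a\<bar> \<in> ?D" by (auto simp: nat_abs_mult_distrib)
      moreover have "a = int (nat \<bar>a\<bar>) \<or> a = - int (nat \<bar>a\<bar>)" by auto
      ultimately show "a \<in> int ` ?D \<union> (\<lambda>d. - int d) ` ?D" by blast
    qed
    then have "card (fst ` ?Z) \<le> card (int ` ?D \<union> (\<lambda>d. - int d) ` ?D)"
      using finD by (intro card_mono finite_UnI finite_imageI)
    also have "\<dots> \<le> card (int ` ?D) + card ((\<lambda>d. - int d) ` ?D)" by (rule card_Un_le)
    also have "\<dots> \<le> card ?D + card ?D" using finD by (intro add_mono card_image_le)
    finally have "card (fst ` ?Z) \<le> 2 * card ?D" by simp
    moreover have "inj_on fst ?Z" using u by (auto simp: inj_on_def)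
    ultimately have "card ?Z \<le> 2 * card ?D" by (simp add: card_image)
    then have "real (card ?Z) \<le> 2 * real (card ?D)" by linarith
    also have "\<dots> \<le> 2 * (C * real ?n powr (\<epsilon> / 2))" using C(2)[of ?n] u by simp
    also have "\<dots> \<le> 2 * (C * (M ^ 2) powr (\<epsilon> / 2))"
    proof -
      have "real ?n = \<bar>real_of_int (fst z)\<bar> * \<bar>real_of_int (snd z)\<bar>"
        using z by (simp flip: abs_mult of_int_mult)
      also have "\<dots> \<le> M * M" using bspec[OF R z(1)] M by (intro mult_mono) auto
      finally have "real ?n \<le> M ^ 2" by (simp add: power2_eq_square)
      then show ?thesis using C assms by (intro mult_left_mono powr_mono2) auto
    qed
    also have "(M ^ 2) powr (\<epsilon> / 2) = M powr \<epsilon>"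
      using M by (simp add: powr_powr flip: powr_numeral)
    finally show ?thesis by simp
  qed
  have "1 \<le> 2 * C" using C by simp
  then show thesis using bound by (intro that[of "2 * C"]) auto
qed

section \<open>Counting solutions coordinate by coordinate\<close>

lemma card_int_dilate_interval_le:
  fixes s c K :: real
  assumes "1 \<le> s" "0 \<le> K"
  shows "finite {k::int. \<bar>s * real_of_int k - c\<bar> \<le> K}" (is "finite ?U")
    and "real (card {k::int. \<bar>s * real_of_int k - c\<bar> \<le> K}) \<le> 2 * K + 1"
proof -
  have sub: "?U \<subseteq> {\<lceil>(c - K) / s\<rceil>..\<lfloor>(c + K) / s\<rfloor>}"
    using assms by (auto simp: ceiling_le_iff le_floor_iff field_simps abs_le_iff)
  then show "finite ?U" by (rule finite_subset) simp
  have "(c + K) / s - (c - K) / s = 2 * K / s" by (simp add: field_simps flip: diff_divide_distrib)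
  also have "\<dots> \<le> 2 * K" using assms by (simp add: divide_le_eq mult_le_cancel_left1)
  finally have len: "(c + K) / s - (c - K) / s \<le> 2 * K" .
  have "card ?U \<le> nat (\<lfloor>(c + K) / s\<rfloor> + 1 - \<lceil>(c - K) / s\<rceil>)"
    using card_mono[OF _ sub] by simp
  moreover have "real (nat (\<lfloor>(c + K) / s\<rfloor> + 1 - \<lceil>(c - K) / s\<rceil>)) \<le> 2 * K + 1"
    using len assms by linarith
  ultimately show "real (card ?U) \<le> 2 * K + 1" by linarith
qed

text \<open>The scale \<open>s\<close> is \<open>1\<close> when \<open>R\<close> holds the first coordinates and \<open>\<gamma>\<close> when it holds the second
  ones; since \<open>s \<ge> 1\<close>, at most \<open>2 * K + 1\<close> values of the product are possible.\<close>

lemma card_products_in_interval_le: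
  fixes R :: "(int \<times> int) set" and s c K D :: real
  assumes "finite R" "1 \<le> s" "0 \<le> K" "0 \<le> D"
    and fibre: "\<And>u. u \<noteq> 0 \<Longrightarrow> real (card {z\<in>R. fst z * snd z = u}) \<le> D"
  shows "real (card {z\<in>R. fst z * snd z \<noteq> 0 \<and> \<bar>s * real_of_int (fst z * snd z) - c\<bar> \<le> K})
    \<le> (2 * K + 1) * D"
proof -
  let ?U = "{k::int. \<bar>s * real_of_int k - c\<bar> \<le> K} - {0}"
  have finU: "finite ?U" using card_int_dilate_interval_le(1)[OF assms(2,3)] by simp
  have "card ?U \<le> card {k::int. \<bar>s * real_of_int k - c\<bar> \<le> K}"
    using card_int_dilate_interval_le(1)[OF assms(2,3)] by (intro card_mono) auto
  then have cardU: "real (card ?U) \<le> 2 * K + 1"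
    using card_int_dilate_interval_le(2)[OF assms(2,3), of c] by linarith
  have "{z\<in>R. fst z * snd z \<noteq> 0 \<and> \<bar>s * real_of_int (fst z * snd z) - c\<bar> \<le> K}
      = (\<Union>u\<in>?U. {z\<in>R. fst z * snd z = u})" by auto
  then have "card {z\<in>R. fst z * snd z \<noteq> 0 \<and> \<bar>s * real_of_int (fst z * snd z) - c\<bar> \<le> K}
      \<le> (\<Sum>u\<in>?U. card {z\<in>R. fst z * snd z = u})"
    using card_UN_le[OF finU] by metis
  then have "real (card {z\<in>R. fst z * snd z \<noteq> 0 \<and> \<bar>s * real_of_int (fst z * snd z) - c\<bar> \<le> K})
      \<le> (\<Sum>u\<in>?U. real (card {z\<in>R. fst z * snd z = u}))"
    unfolding of_nat_sum[symmetric] of_nat_le_iff .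
  also have "\<dots> \<le> (\<Sum>u\<in>?U. D)" by (intro sum_mono fibre) auto
  also have "\<dots> = real (card ?U) * D" by simp
  also have "\<dots> \<le> (2 * K + 1) * D" using cardU assms by (intro mult_right_mono) auto
  finally show ?thesis .
qed

lemma card_le_by_sections:
  fixes A :: "'a set" and B :: "'b set" and k :: real
  assumes "finite A" "finite B" and "\<And>x. x \<in> A \<Longrightarrow> real (card {y\<in>B. P x y}) \<le> k"
  shows "real (card {(x, y). x \<in> A \<and> y \<in> B \<and> P x y}) \<le> real (card A) * k"
proof -
  have "{(x, y). x \<in> A \<and> y \<in> B \<and> P x y} = Sigma A (\<lambda>x. {y\<in>B. P x y})" by auto
  then have "real (card {(x, y). x \<in> A \<and> y \<in> B \<and> P x y}) = (\<Sum>x\<in>A. real (card {y\<in>B. P x y}))"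
    using assms by simp
  also have "\<dots> \<le> (\<Sum>x\<in>A. k)" using assms by (intro sum_mono) auto
  finally show ?thesis by simp
qed

text \<open>The pairs are grouped by coordinate: \<open>z = (a\<^sub>1, b\<^sub>1)\<close> and \<open>w = (a\<^sub>2, b\<^sub>2)\<close>. This makes the ranges
  \<open>R\<close> and \<open>R'\<close> of the two coordinates independent of each other.\<close>

definition near_solutions ::
  "real \<Rightarrow> real \<Rightarrow> real \<Rightarrow> (int \<times> int) set \<Rightarrow> (int \<times> int) set \<Rightarrow> ((int \<times> int) \<times> (int \<times> int)) set"
  where "near_solutions \<gamma> K \<mu> R R' = {(z, w). z \<in> R \<and> w \<in> R' \<and>
     (fst z \<noteq> 0 \<or> fst w \<noteq> 0) \<and> (snd z \<noteq> 0 \<or> snd w \<noteq> 0) \<and>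
     \<bar>real_of_int (fst z * snd z) + \<gamma> * real_of_int (fst w * snd w) - \<mu>\<bar> \<le> K}"

text \<open>The hypotheses on the slices \<open>fst z = 0\<close> and \<open>snd z = 0\<close> serve the degenerate solutions: these
  lie in products of one slice of \<open>R\<close> with the opposite slice of \<open>R'\<close>, and every such product has
  at most \<open>A * B\<close> elements.\<close>

lemma card_near_solutions_le:
  fixes R R' :: "(int \<times> int) set" and \<gamma> K \<mu> A B D :: real
  assumes fin: "finite R" "finite R'" and \<gamma>: "1 \<le> \<gamma>" and K: "0 \<le> K"
    and AB: "0 \<le> A" "0 \<le> B" and D: "1 \<le> D"
    and cR: "real (card R) \<le> A * B" "real (card R') \<le> A * B"
    and fst0: "real (card {z\<in>R. fst z = 0}) \<le> A" "real (card {z\<in>R'. fst z = 0}) \<le> A"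
    and snd0: "real (card {z\<in>R. snd z = 0}) \<le> B" "real (card {z\<in>R'. snd z = 0}) \<le> B"
    and fibre: "\<And>u. u \<noteq> 0 \<Longrightarrow> real (card {z\<in>R. fst z * snd z = u}) \<le> D"
      "\<And>u. u \<noteq> 0 \<Longrightarrow> real (card {z\<in>R'. fst z * snd z = u}) \<le> D"
  shows "finite (near_solutions \<gamma> K \<mu> R R')"
    and "real (card (near_solutions \<gamma> K \<mu> R R')) \<le> (4 * K + 4) * D * (A * B)"
proof -
  let ?Q = "near_solutions \<gamma> K \<mu> R R'"
  let ?close = "\<lambda>z w. \<bar>real_of_int (fst z * snd z) + \<gamma> * real_of_int (fst w * snd w) - \<mu>\<bar> \<le> K"
  let ?Q1 = "{(w, z). w \<in> R' \<and> z \<in> R \<and> (fst z * snd z \<noteq> 0 \<and> ?close z w)}"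
  let ?Q2 = "{(z, w). z \<in> R \<and> w \<in> R' \<and> (fst w * snd w \<noteq> 0 \<and> ?close z w)}"
  let ?Q3 = "{z\<in>R. fst z = 0} \<times> {w\<in>R'. snd w = 0}"
  let ?Q4 = "{z\<in>R. snd z = 0} \<times> {w\<in>R'. fst w = 0}"
  show finQ: "finite ?Q"
    by (rule finite_subset[of _ "R \<times> R'"]) (use fin in \<open>auto simp: near_solutions_def\<close>)
  \<comment> \<open>The four sets collect the solutions with \<open>a\<^sub>1 b\<^sub>1 \<noteq> 0\<close>, with \<open>a\<^sub>2 b\<^sub>2 \<noteq> 0\<close>, with
      \<open>a\<^sub>1 = b\<^sub>2 = 0\<close> and with \<open>b\<^sub>1 = a\<^sub>2 = 0\<close>. The first is swapped because its sections are
      taken over the second coordinates.\<close>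
  have sub: "?Q \<subseteq> prod.swap ` ?Q1 \<union> ?Q2 \<union> (?Q3 \<union> ?Q4)"
    unfolding near_solutions_def by force
  have fin1: "finite ?Q1" by (rule finite_subset[of _ "R' \<times> R"]) (use fin in auto)
  have fin2: "finite ?Q2" by (rule finite_subset[of _ "R \<times> R'"]) (use fin in auto)
  have "card ?Q \<le> card (prod.swap ` ?Q1 \<union> ?Q2 \<union> (?Q3 \<union> ?Q4))"
    using sub fin fin1 fin2 by (intro card_mono) auto
  also have "\<dots> \<le> card (prod.swap ` ?Q1) + card ?Q2 + (card ?Q3 + card ?Q4)"
    by (intro order_trans[OF card_Un_le] add_mono card_Un_le order_refl)
  also have "card (prod.swap ` ?Q1) = card ?Q1" by (rule card_image) simp
  finally have "real (card ?Q) \<le> real (card ?Q1) + real (card ?Q2) + (real (card ?Q3) + real (card ?Q4))"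
    by linarith
  moreover have "real (card ?Q1) \<le> A * B * ((2 * K + 1) * D)"
  proof -
    have "real (card {z\<in>R. fst z * snd z \<noteq> 0 \<and> ?close z w}) \<le> (2 * K + 1) * D" for w
      using card_products_in_interval_le[OF fin(1) order_refl K _ fibre(1),
          where c = "\<mu> - \<gamma> * real_of_int (fst w * snd w)"] D
      by (simp add: algebra_simps)
    then have "real (card ?Q1) \<le> real (card R') * ((2 * K + 1) * D)"
      by (intro card_le_by_sections fin)
    also have "\<dots> \<le> A * B * ((2 * K + 1) * D)" using cR K D by (intro mult_right_mono) auto
    finally show ?thesis .
  qed
  moreover have "real (card ?Q2) \<le> A * B * ((2 * K + 1) * D)"
  proof -
    have "real (card {w\<in>R'. fst w * snd w \<noteq> 0 \<and> ?close z w}) \<le> (2 * K + 1) * D" for z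
      using card_products_in_interval_le[OF fin(2) \<gamma> K _ fibre(2),
          where c = "\<mu> - real_of_int (fst z * snd z)"] D
      by (simp add: algebra_simps)
    then have "real (card ?Q2) \<le> real (card R) * ((2 * K + 1) * D)"
      by (intro card_le_by_sections fin)
    also have "\<dots> \<le> A * B * ((2 * K + 1) * D)" using cR K D by (intro mult_right_mono) auto
    finally show ?thesis .
  qed
  moreover have "real (card ?Q3) \<le> A * B"
    using mult_mono[OF fst0(1) snd0(2)] AB by (simp add: card_cartesian_product)
  moreover have "real (card ?Q4) \<le> A * B"
    using mult_mono[OF snd0(1) fst0(2)] AB by (simp add: card_cartesian_product mult.commute)
  ultimately have "real (card ?Q) \<le> 2 * (A * B * ((2 * K + 1) * D)) + 2 * (A * B)" by linarith
  also have "\<dots> \<le> 2 * (A * B * ((2 * K + 1) * D)) + 2 * (A * B * D)"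
    using mult_left_mono[OF D, of "A * B"] AB by simp
  also have "\<dots> = (4 * K + 4) * D * (A * B)" by (simp add: algebra_simps)
  finally show "real (card ?Q) \<le> (4 * K + 4) * D * (A * B)" .
qed

lemma near_solutions_subpolynomial:
  fixes \<gamma> K \<epsilon> :: real
  assumes "1 \<le> \<gamma>" "0 \<le> K" "0 < \<epsilon>"
  obtains C where "0 < C"
    and "\<forall>M\<ge>1. \<forall>A\<ge>0. \<forall>B\<ge>0. \<forall>\<mu> R R'. finite R \<longrightarrow> finite R' \<longrightarrow>
      (\<forall>z \<in> R \<union> R'. \<bar>real_of_int (fst z)\<bar> \<le> M \<and> \<bar>real_of_int (snd z)\<bar> \<le> M) \<longrightarrow>
      (\<forall>Z \<in> {R, R'}. real (card Z) \<le> A * B \<and>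
         real (card {z\<in>Z. fst z = 0}) \<le> A \<and> real (card {z\<in>Z. snd z = 0}) \<le> B) \<longrightarrow>
      card_bounded (near_solutions \<gamma> K \<mu> R R') (C * M powr \<epsilon> * (A * B))"
proof -
  obtain D where D: "1 \<le> D" and fibre: "\<forall>M\<ge>1. \<forall>u\<noteq>0. \<forall>R :: (int \<times> int) set.
      (\<forall>z\<in>R. \<bar>real_of_int (fst z)\<bar> \<le> M \<and> \<bar>real_of_int (snd z)\<bar> \<le> M) \<longrightarrow>
      real (card {z\<in>R. fst z * snd z = u}) \<le> D * M powr \<epsilon>"
    using card_factor_pairs_subpolynomial[OF assms(3)] by blast
  have bound: "card_bounded (near_solutions \<gamma> K \<mu> R R') ((4 * K + 4) * D * M powr \<epsilon> * (A * B))"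
    if M: "1 \<le> M" and AB: "0 \<le> A" "0 \<le> B" and fin: "finite R" "finite R'"
      and box: "\<forall>z \<in> R \<union> R'. \<bar>real_of_int (fst z)\<bar> \<le> M \<and> \<bar>real_of_int (snd z)\<bar> \<le> M"
      and sizes: "\<forall>Z \<in> {R, R'}. real (card Z) \<le> A * B \<and>
        real (card {z\<in>Z. fst z = 0}) \<le> A \<and> real (card {z\<in>Z. snd z = 0}) \<le> B"
    for M A B \<mu> and R R' :: "(int \<times> int) set"
  proof -
    have "1 * 1 \<le> D * M powr \<epsilon>"
      using D M assms by (intro mult_mono ge_one_powr_ge_zero) auto
    then have D': "1 \<le> D * M powr \<epsilon>" by simp
    have "real (card {z\<in>R. fst z * snd z = u}) \<le> D * M powr \<epsilon>"
      "real (card {z\<in>R'. fst z * snd z = u}) \<le> D * M powr \<epsilon>" if "u \<noteq> 0" for u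
      using fibre M that box by simp_all
    note card_near_solutions_le[OF fin assms(1,2) AB D' _ _ _ _ _ _ this]
    then show ?thesis
      using sizes by (simp add: card_bounded_def mult_ac)
  qed
  have "0 < (4 * K + 4) * D" using assms D by simp
  then show thesis using bound by (intro that[of "(4 * K + 4) * D"]) auto
qed

section \<open>The three sets\<close>

lemma coordinate_le_norm_g:
  assumes "1 < \<gamma>"
  shows "\<bar>real_of_int (fst n)\<bar> \<le> norm_g \<gamma> n" "\<bar>real_of_int (snd n)\<bar> \<le> norm_g \<gamma> n"
proof -
  have "\<gamma> * (real_of_int (snd n))\<^sup>2 \<ge> 1 * (real_of_int (snd n))\<^sup>2"
    using assms by (intro mult_right_mono) auto
  moreover have "inner_g \<gamma> n n = (real_of_int (fst n))\<^sup>2 + \<gamma> * (real_of_int (snd n))\<^sup>2"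
    by (simp add: inner_g_def power2_eq_square mult.assoc)
  ultimately have "(real_of_int (fst n))\<^sup>2 \<le> inner_g \<gamma> n n" "(real_of_int (snd n))\<^sup>2 \<le> inner_g \<gamma> n n"
    using zero_le_power2[of "real_of_int (fst n)"] zero_le_power2[of "real_of_int (snd n)"]
    by linarith+
  then show "\<bar>real_of_int (fst n)\<bar> \<le> norm_g \<gamma> n" "\<bar>real_of_int (snd n)\<bar> \<le> norm_g \<gamma> n"
    unfolding norm_g_def using real_sqrt_le_mono by fastforce+
qed

definition int_ball :: "real \<Rightarrow> int set" where
  "int_ball X = {x. \<bar>real_of_int x\<bar> \<le> X}"

lemma finite_int_ball: "finite (int_ball X)"
  by (rule finite_subset[of _ "{-\<lfloor>X\<rfloor>..\<lfloor>X\<rfloor>}"]) (auto simp: int_ball_def, linarith+)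

lemma card_int_ball_le: "1 \<le> X \<Longrightarrow> real (card (int_ball X)) \<le> 3 * X"
  using card_int_dilate_interval_le(2)[of 1 X 0] by (simp add: int_ball_def)

lemma comparable_imp_int_ball:
  assumes "1 < \<gamma>" "comparable K (norm_g \<gamma> n) N"
  shows "fst n \<in> int_ball (K * N)" "snd n \<in> int_ball (K * N)"
  using coordinate_le_norm_g[OF assms(1), of n] assms(2)
  by (auto simp: comparable_def int_ball_def)

lemma card_bounded_inj_on:
  assumes "card_bounded B b" "inj_on f A" "f ` A \<subseteq> B"
  shows "card_bounded A b"
proof -
  have "finite A" using assms by (meson card_bounded_def finite_imageD finite_subset)
  moreover have "card A \<le> card B"
    using assms by (auto simp: card_bounded_def intro: card_inj_on_le)
  ultimately show ?thesis using assms by (auto simp: card_bounded_def)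
qed

lemma card_image_box_le:
  assumes "1 \<le> X" "1 \<le> Y"
  shows "real (card (f ` (int_ball X \<times> int_ball Y))) \<le> (3 * Y) * (3 * X)"
proof -
  have "card (f ` (int_ball X \<times> int_ball Y)) \<le> card (int_ball X \<times> int_ball Y)"
    by (intro card_image_le finite_cartesian_product finite_int_ball)
  then have "real (card (f ` (int_ball X \<times> int_ball Y))) \<le> real (card (int_ball X)) * real (card (int_ball Y))"
    unfolding card_cartesian_product by (metis of_nat_le_iff of_nat_mult)
  also have "\<dots> \<le> (3 * X) * (3 * Y)"
    using assms by (intro mult_mono card_int_ball_le) auto
  finally show ?thesis by (simp add: mult_ac)
qed

lemma card_le_of_int_ball_image:
  assumes "1 \<le> X" "Z \<subseteq> f ` int_ball X"
  shows "real (card Z) \<le> 3 * X"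
proof -
  have "card Z \<le> card (int_ball X)" by (rule surj_card_le[OF finite_int_ball assms(2)])
  then show ?thesis using card_int_ball_le[OF assms(1)] by linarith
qed

text \<open>The values \<open>(a\<^sub>i, b\<^sub>i)\<close> in one coordinate. If the fixed vector is \<open>n1\<close>, with coordinate \<open>p\<close>, the free
  coordinates \<open>x\<close> of \<open>n2\<close> and \<open>y\<close> of \<open>n3\<close> give \<open>outer_shifts\<close>; if it is \<open>n2\<close>, the free coordinates
  \<open>x\<close> of \<open>n1\<close> and \<open>y\<close> of \<open>n3\<close> give \<open>middle_shifts\<close>.\<close>

definition outer_shifts :: "real \<Rightarrow> real \<Rightarrow> int \<Rightarrow> (int \<times> int) set" where
  "outer_shifts X Y p = (\<lambda>(x, y). (x - p, x - y)) ` (int_ball X \<times> int_ball Y)"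

definition middle_shifts :: "real \<Rightarrow> real \<Rightarrow> int \<Rightarrow> (int \<times> int) set" where
  "middle_shifts X Y p = (\<lambda>(x, y). (p - x, p - y)) ` (int_ball X \<times> int_ball Y)"

text \<open>Fixing \<open>x - p = 0\<close> determines \<open>x\<close> and leaves \<open>y\<close> free; \<open>x - y = 0\<close> determines \<open>y\<close> from \<open>x\<close>.\<close>

lemma outer_shifts_bounds:
  assumes "1 \<le> X" "1 \<le> Y"
  shows "finite (outer_shifts X Y p)"
    "real (card (outer_shifts X Y p)) \<le> (3 * Y) * (3 * X)"
    "real (card {z\<in>outer_shifts X Y p. fst z = 0}) \<le> 3 * Y"
    "real (card {z\<in>outer_shifts X Y p. snd z = 0}) \<le> 3 * X"
proof -
  show "finite (outer_shifts X Y p)"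
    unfolding outer_shifts_def by (intro finite_imageI finite_cartesian_product finite_int_ball)
  show "real (card (outer_shifts X Y p)) \<le> (3 * Y) * (3 * X)"
    unfolding outer_shifts_def by (rule card_image_box_le[OF assms])
  show "real (card {z\<in>outer_shifts X Y p. fst z = 0}) \<le> 3 * Y"
    by (rule card_le_of_int_ball_image[OF assms(2), of _ "\<lambda>y. (0, p - y)"])
      (auto simp: outer_shifts_def)
  show "real (card {z\<in>outer_shifts X Y p. snd z = 0}) \<le> 3 * X"
    by (rule card_le_of_int_ball_image[OF assms(1), of _ "\<lambda>x. (x - p, 0)"])
      (auto simp: outer_shifts_def)
qed

lemma middle_shifts_bounds:
  assumes "1 \<le> X" "1 \<le> Y"
  shows "finite (middle_shifts X Y p)"
    "real (card (middle_shifts X Y p)) \<le> (3 * Y) * (3 * X)"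
    "real (card {z\<in>middle_shifts X Y p. fst z = 0}) \<le> 3 * Y"
    "real (card {z\<in>middle_shifts X Y p. snd z = 0}) \<le> 3 * X"
proof -
  show "finite (middle_shifts X Y p)"
    unfolding middle_shifts_def by (intro finite_imageI finite_cartesian_product finite_int_ball)
  show "real (card (middle_shifts X Y p)) \<le> (3 * Y) * (3 * X)"
    unfolding middle_shifts_def by (rule card_image_box_le[OF assms])
  show "real (card {z\<in>middle_shifts X Y p. fst z = 0}) \<le> 3 * Y"
    by (rule card_le_of_int_ball_image[OF assms(2), of _ "\<lambda>y. (0, p - y)"])
      (auto simp: middle_shifts_def)
  show "real (card {z\<in>middle_shifts X Y p. snd z = 0}) \<le> 3 * X"
    by (rule card_le_of_int_ball_image[OF assms(1), of _ "\<lambda>x. (p - x, 0)"])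
      (auto simp: middle_shifts_def)
qed

lemma shifts_in_box:
  assumes "p \<in> int_ball m" "X \<le> m" "Y \<le> m" "z \<in> outer_shifts X Y p \<union> middle_shifts X Y p"
  shows "\<bar>real_of_int (fst z)\<bar> \<le> 2 * m \<and> \<bar>real_of_int (snd z)\<bar> \<le> 2 * m"
  using assms by (auto simp: outer_shifts_def middle_shifts_def int_ball_def)

lemma card_bounded_empty: "0 \<le> b \<Longrightarrow> card_bounded {} b"
  by (simp add: card_bounded_def)

definition coordinate_pairs ::
  "(int \<times> int) \<times> (int \<times> int) \<Rightarrow> (int \<times> int) \<times> (int \<times> int)" where
  "coordinate_pairs = (\<lambda>(a, b). ((fst a, fst b), (snd a, snd b)))"

lemma coordinate_pairs_in_near_solutions:
  assumes "(n1, n2, n3) \<in> S \<gamma> K N1 N2 N3 \<mu>"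
    and "(fst (n2 - n1), fst (n2 - n3)) \<in> R" "(snd (n2 - n1), snd (n2 - n3)) \<in> R'"
  shows "coordinate_pairs (n2 - n1, n2 - n3) \<in> near_solutions \<gamma> K \<mu> R R'"
  using assms unfolding S_def near_solutions_def coordinate_pairs_def inner_g_def within_O1_def
  by (auto simp: prod_eq_iff mult.assoc)

lemma S1_subset:
  assumes "1 < \<gamma>"
  shows "(\<lambda>(n2, n3). coordinate_pairs (n2 - n1, n2 - n3)) ` S1 \<gamma> K N1 N2 N3 \<mu> n1
    \<subseteq> near_solutions \<gamma> K \<mu> (outer_shifts (K * N2) (K * N3) (fst n1)) (outer_shifts (K * N2) (K * N3) (snd n1))"
proof (rule image_subsetI)
  fix q assume q: "q \<in> S1 \<gamma> K N1 N2 N3 \<mu> n1"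
  obtain n2 n3 where qn: "q = (n2, n3)" by (cases q)
  from q have n: "(n1, n2, n3) \<in> S \<gamma> K N1 N2 N3 \<mu>" by (simp add: qn S1_def)
  then have "comparable K (norm_g \<gamma> n2) N2" "comparable K (norm_g \<gamma> n3) N3" by (auto simp: S_def)
  note b = this[THEN comparable_imp_int_ball(1)[OF assms]] this[THEN comparable_imp_int_ball(2)[OF assms]]
  show "(\<lambda>(n2, n3). coordinate_pairs (n2 - n1, n2 - n3)) q \<in> near_solutions \<gamma> K \<mu>
     (outer_shifts (K * N2) (K * N3) (fst n1)) (outer_shifts (K * N2) (K * N3) (snd n1))"
    unfolding qn prod.case by (rule coordinate_pairs_in_near_solutions[OF n]) (use b in \<open>force simp: outer_shifts_def\<close>)+
qed

lemma S2_subset: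
  assumes "1 < \<gamma>"
  shows "(\<lambda>(n1, n3). coordinate_pairs (n2 - n1, n2 - n3)) ` S2 \<gamma> K N1 N2 N3 \<mu> n2
    \<subseteq> near_solutions \<gamma> K \<mu> (middle_shifts (K * N1) (K * N3) (fst n2)) (middle_shifts (K * N1) (K * N3) (snd n2))"
proof (rule image_subsetI)
  fix q assume q: "q \<in> S2 \<gamma> K N1 N2 N3 \<mu> n2"
  obtain n1 n3 where qn: "q = (n1, n3)" by (cases q)
  from q have n: "(n1, n2, n3) \<in> S \<gamma> K N1 N2 N3 \<mu>" by (simp add: qn S2_def)
  then have "comparable K (norm_g \<gamma> n1) N1" "comparable K (norm_g \<gamma> n3) N3" by (auto simp: S_def)
  note b = this[THEN comparable_imp_int_ball(1)[OF assms]] this[THEN comparable_imp_int_ball(2)[OF assms]]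
  show "(\<lambda>(n1, n3). coordinate_pairs (n2 - n1, n2 - n3)) q \<in> near_solutions \<gamma> K \<mu>
     (middle_shifts (K * N1) (K * N3) (fst n2)) (middle_shifts (K * N1) (K * N3) (snd n2))"
    unfolding qn prod.case by (rule coordinate_pairs_in_near_solutions[OF n]) (use b in \<open>force simp: middle_shifts_def\<close>)+
qed

text \<open>The form is symmetric in \<open>n2 - n1\<close> and \<open>n2 - n3\<close>, so the roles of \<open>n1\<close> and \<open>n3\<close> can be
  exchanged.\<close>

lemma S3_swap:
  "prod.swap ` S3 \<gamma> K N1 N2 N3 \<mu> n3 \<subseteq> S1 \<gamma> K N3 N2 N1 \<mu> n3"
  by (auto simp: S3_def S1_def S_def inner_g_def mult_ac)

theorem lemma4p5:
  fixes \<gamma> K :: real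
  assumes "1 < \<gamma>" and "\<gamma> < 2" and "K \<ge> 1"
  shows "\<forall>\<epsilon>::real. \<epsilon> > 0 \<longrightarrow> (\<exists>C::real. C > 0 \<and>
    (\<forall>(N1::real) (N2::real) (N3::real) (\<mu>::real).
       N1 \<ge> 1 \<and> N2 \<ge> 1 \<and> N3 \<ge> 1 \<and> \<bar>\<mu>\<bar> \<le> K * Max {N1, N2, N3} \<longrightarrow>
         (\<forall>n1. card_bounded (S1 \<gamma> K N1 N2 N3 \<mu> n1) (C * Max {N1, N2, N3} powr \<epsilon> * N2 * N3)) \<and>
         (\<forall>n2. card_bounded (S2 \<gamma> K N1 N2 N3 \<mu> n2) (C * Max {N1, N2, N3} powr \<epsilon> * N1 * N3)) \<and>
         (\<forall>n3. card_bounded (S3 \<gamma> K N1 N2 N3 \<mu> n3) (C * Max {N1, N2, N3} powr \<epsilon> * N1 * N2))))"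
proof (intro allI impI)
  fix \<epsilon> :: real assume \<epsilon>: "\<epsilon> > 0"
  from assms have \<gamma>K: "1 \<le> \<gamma>" "0 \<le> K" by auto
  obtain C0 where C0: "0 < C0" and count: "\<forall>M\<ge>1. \<forall>A\<ge>0. \<forall>B\<ge>0. \<forall>\<mu> R R'. finite R \<longrightarrow> finite R' \<longrightarrow>
      (\<forall>z \<in> R \<union> R'. \<bar>real_of_int (fst z)\<bar> \<le> M \<and> \<bar>real_of_int (snd z)\<bar> \<le> M) \<longrightarrow>
      (\<forall>Z \<in> {R, R'}. real (card Z) \<le> A * B \<and>
         real (card {z\<in>Z. fst z = 0}) \<le> A \<and> real (card {z\<in>Z. snd z = 0}) \<le> B) \<longrightarrow>
      card_bounded (near_solutions \<gamma> K \<mu> R R') (C0 * M powr \<epsilon> * (A * B))"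
    using near_solutions_subpolynomial[OF \<gamma>K \<epsilon>] by blast
  define C where "C = C0 * (2 * K) powr \<epsilon> * (9 * K\<^sup>2)"
  have Cpos: "C > 0" using C0 assms by (simp add: C_def)
  have rescale: "C0 * (2 * (K * m)) powr \<epsilon> * ((3 * (K * Y)) * (3 * (K * X))) = C * m powr \<epsilon> * X * Y"
    for m X Y :: real
    using powr_mult[of "2 * K" m \<epsilon>] by (simp add: C_def power2_eq_square mult_ac)
  have KN: "1 \<le> K * N" if "1 \<le> N" for N using mult_mono[of 1 K 1 N] that assms by simp
  have bound1: "card_bounded (S1 \<gamma> K N1 N2 N3 \<mu> n1) (C * m powr \<epsilon> * N2 * N3)"
    if N: "N2 \<ge> 1" "N3 \<ge> 1" "N1 \<le> m" "N2 \<le> m" "N3 \<le> m" for N1 N2 N3 \<mu> m n1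
  proof (cases "comparable K (norm_g \<gamma> n1) N1")
    \<comment> \<open>A fixed vector of the wrong size admits no solutions; otherwise it is bounded by
        \<open>K * m\<close>, which makes the constant independent of it.\<close>
    case False
    then have "S1 \<gamma> K N1 N2 N3 \<mu> n1 = {}" by (simp add: S1_def S_def)
    then show ?thesis using Cpos N by (simp add: card_bounded_empty)
  next
    case True
    have le: "K * N \<le> K * m" if "N \<le> m" for N using that assms by simp
    have "fst n1 \<in> int_ball (K * m)" "snd n1 \<in> int_ball (K * m)"
      using comparable_imp_int_ball[OF assms(1) True] le[OF N(3)] by (auto simp: int_ball_def)
    note box = this[THEN shifts_in_box[OF _ le[OF N(4)] le[OF N(5)]]]
    let ?R = "outer_shifts (K * N2) (K * N3)"
    have "card_bounded (near_solutions \<gamma> K \<mu> (?R (fst n1)) (?R (snd n1)))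
        (C0 * (2 * (K * m)) powr \<epsilon> * ((3 * (K * N3)) * (3 * (K * N2))))"
    proof (rule count[rule_format])
      show "1 \<le> 2 * (K * m)" using KN[of m] N by linarith
    qed (use box outer_shifts_bounds[OF KN KN, OF N(1,2)] KN[OF N(1)] KN[OF N(2)] in auto)
    then show ?thesis unfolding rescale
      by (rule card_bounded_inj_on[OF _ _ S1_subset[OF assms(1)]])
        (auto simp: inj_on_def coordinate_pairs_def prod_eq_iff)
  qed
  have bound2: "card_bounded (S2 \<gamma> K N1 N2 N3 \<mu> n2) (C * m powr \<epsilon> * N1 * N3)"
    if N: "N1 \<ge> 1" "N3 \<ge> 1" "N2 \<le> m" "N1 \<le> m" "N3 \<le> m" for N1 N2 N3 \<mu> m n2
  proof (cases "comparable K (norm_g \<gamma> n2) N2")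
    case False
    then have "S2 \<gamma> K N1 N2 N3 \<mu> n2 = {}" by (simp add: S2_def S_def)
    then show ?thesis using Cpos N by (simp add: card_bounded_empty)
  next
    case True
    have le: "K * N \<le> K * m" if "N \<le> m" for N using that assms by simp
    have "fst n2 \<in> int_ball (K * m)" "snd n2 \<in> int_ball (K * m)"
      using comparable_imp_int_ball[OF assms(1) True] le[OF N(3)] by (auto simp: int_ball_def)
    note box = this[THEN shifts_in_box[OF _ le[OF N(4)] le[OF N(5)]]]
    let ?R = "middle_shifts (K * N1) (K * N3)"
    have "card_bounded (near_solutions \<gamma> K \<mu> (?R (fst n2)) (?R (snd n2)))
        (C0 * (2 * (K * m)) powr \<epsilon> * ((3 * (K * N3)) * (3 * (K * N1))))"
    proof (rule count[rule_format])
      show "1 \<le> 2 * (K * m)" using KN[of m] N by linarith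
    qed (use box middle_shifts_bounds[OF KN KN, OF N(1,2)] KN[OF N(1)] KN[OF N(2)] in auto)
    then show ?thesis unfolding rescale
      by (rule card_bounded_inj_on[OF _ _ S2_subset[OF assms(1)]])
        (auto simp: inj_on_def coordinate_pairs_def prod_eq_iff)
  qed
  have bound3: "card_bounded (S3 \<gamma> K N1 N2 N3 \<mu> n3) (C * m powr \<epsilon> * N1 * N2)"
    if N: "N2 \<ge> 1" "N1 \<ge> 1" "N3 \<le> m" "N2 \<le> m" "N1 \<le> m" for N1 N2 N3 \<mu> m n3
    using card_bounded_inj_on[OF bound1[OF N] _ S3_swap] by (simp add: mult_ac)
  show "\<exists>C>0. \<forall>N1 N2 N3 \<mu>.
       N1 \<ge> 1 \<and> N2 \<ge> 1 \<and> N3 \<ge> 1 \<and> \<bar>\<mu>\<bar> \<le> K * Max {N1, N2, N3} \<longrightarrow>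
         (\<forall>n1. card_bounded (S1 \<gamma> K N1 N2 N3 \<mu> n1) (C * Max {N1, N2, N3} powr \<epsilon> * N2 * N3)) \<and>
         (\<forall>n2. card_bounded (S2 \<gamma> K N1 N2 N3 \<mu> n2) (C * Max {N1, N2, N3} powr \<epsilon> * N1 * N3)) \<and>
         (\<forall>n3. card_bounded (S3 \<gamma> K N1 N2 N3 \<mu> n3) (C * Max {N1, N2, N3} powr \<epsilon> * N1 * N2))"
    using Cpos by (intro exI[of _ C] conjI allI impI bound1 bound2 bound3) auto
qed

end
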